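(* For every $S\subset[n+1]$, the map $\tilde\omega_S$ is a cochain homomorphism of the Aomoto complex $(A_R^\bullet(\mathcal{G}),a_y)$; that is, $\tilde\omega_S^{p+1}(a_y\,\eta)=a_y\,\tilde\omega_S^p(\eta)$ for all $p$ and all $\eta\in A_R^p(\mathcal{G})$.
   Context: Fix $n\ge\ell\ge1$; $[n]=\{1,\dots,n\}$, $[n+1]=\{1,\dots,n+1\}$ (the index $n+1$ stands for the hyperplane at infinity). Let $E$ be the exterior algebra over $\mathbb{C}$ on $a_1,\dots,a_n$. For a tuple $T=(i_1,\dots,i_q)$ of elements of $[n]$, $a_T=a_{i_1}\cdots a_{i_q}$ and $\partial a_T=\sum_{k=1}^q(-1)^{k-1}a_{i_1}\cdots\widehat{a_{i_k}}\cdots a_{i_q}$, with $\partial 1=0$. Let $A^\bullet(\mathcal{G})$ be the Orlik-Solomon algebra of a general position arrangement of $n$ hyperplanes in $\mathbb{C}^\ell$, i.e. $E$ modulo all elements of degree $>\ell$. With $R=\mathbb{C}[y_1,\dots,y_n]$ and $a_y=\sum_{j=1}^n y_ja_j$, the Aomoto complex $(A_R^\bullet(\mathcal{G}),a_y)$ has terms $A_R^q(\mathcal{G})=R\otimes_{\mathbb{C}}A^q(\mathcal{G})$ and differential left multiplication by $a_y$. For a $p$-tuple $T=(i_1,\dots,i_p)$ in $[n]$, $T_k$ is the $(p-1)$-tuple obtained by deleting $i_k$, and $(j,T)=(j,i_1,\dots,i_p)$. Write $S\equiv T$ if $S$ and $T$ are equal as sets. Tuples contain only indices in $[n]$; sets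 may contain $n+1$; $1\le j\le n$. Expressions $\partial a_{(j,T)}$ are computed in $E$ and then mapped to $A_R(\mathcal{G})$. For $S\subset[n+1]$ with $|S|=q+1$, $\tilde\omega_S$ is the $R$-linear endomorphism of $A_R^\bullet(\mathcal{G})$ given on $p$-tuples $T$ as follows. If $n+1\notin S$: $\tilde\omega_S^p(a_T)=y_j\,\partial a_{(j,T)}$ if $p=q$ and $S\equiv(j,T)$; $=a_y\,\partial a_T$ if $p=q+1$ and $S\equiv T$; $=0$ otherwise. If $n+1\in S$: $\tilde\omega_S^p(a_T)=-\bigl(\sum_{j\in[n]\setminus T}y_j\bigr)a_T$ if $p=q$ and $S\equiv T\cup\{n+1\}$; $=(-1)^{k-1}y_j\,a_{(j,T_k)}$ if $p=q$, $S\equiv(j,T_k)\cup\{n+1\}$ and $j\notin T$; $=(-1)^k a_y\,a_{T_k}$ if $p=q+1$ and $S\equiv T_k\cup\{n+1\}$; $=0$ otherwise. *)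

theory Defs
  imports Complex_Main "HOL-Library.Poly_Mapping"
begin

section \<open>The polynomial ring\<close>

type_synonym cpoly = "(nat \<Rightarrow>\<^sub>0 nat) \<Rightarrow>\<^sub>0 complex"

definition poly_ring :: "nat \<Rightarrow> cpoly set" where
  "poly_ring n = {f. \<forall>m\<in>Poly_Mapping.keys f. Poly_Mapping.keys m \<subseteq> {1..n}}"

definition var :: "nat \<Rightarrow> cpoly" where
  "var j = Poly_Mapping.single (Poly_Mapping.single j 1) 1"


section \<open>The exterior algebra\<close>

text \<open>
  The exterior algebra over a commutative ring on generators \<open>a\<^sub>1, a\<^sub>2, \<dots>\<close> is realised on its
  standard basis: the key \<open>I = {i\<^sub>1 < \<dots> < i\<^sub>q}\<close> stands for \<open>a\<^bsub>i\<^sub>1\<^esub> \<cdots> a\<^bsub>i\<^sub>q\<^esub>\<close>. The algebra on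
  \<open>a\<^sub>1, \<dots>, a\<^sub>n\<close> consists of the elements all of whose keys are subsets of \<open>{1..n}\<close>; infinite keys
  are junk. Over the coefficient ring \<open>R\<close> this is \<open>R \<otimes> E\<close>.
\<close>

type_synonym 'r ext = "nat set \<Rightarrow>\<^sub>0 'r"

definition smul :: "'r::comm_ring_1 \<Rightarrow> 'r ext \<Rightarrow> 'r ext" where
  "smul r x = Poly_Mapping.map ((*) r) x"

text \<open>The sign of the permutation that sorts the concatenation of \<open>I\<close> and \<open>J\<close>.\<close>

definition koszul :: "nat set \<Rightarrow> nat set \<Rightarrow> 'r::comm_ring_1" where
  "koszul I J =
     (if I \<inter> J = {} then (-1) ^ card {(i, j). i \<in> I \<and> j \<in> J \<and> j < i} else 0)"

definition wedge :: "'r::comm_ring_1 ext \<Rightarrow> 'r ext \<Rightarrow> 'r ext" where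
  "wedge x y = (\<Sum>I\<in>Poly_Mapping.keys x. \<Sum>J\<in>Poly_Mapping.keys y.
     Poly_Mapping.single (I \<union> J)
       (koszul I J * (Poly_Mapping.lookup x I * Poly_Mapping.lookup y J)))"

definition gen :: "nat \<Rightarrow> 'r::comm_ring_1 ext" where
  "gen i = Poly_Mapping.single {i} 1"

text \<open>\<open>a\<^sub>T\<close> for a tuple \<open>T\<close>, represented as a list.\<close>

definition mon :: "nat list \<Rightarrow> 'r::comm_ring_1 ext" where
  "mon T = foldr (\<lambda>i x. wedge (gen i) x) T (Poly_Mapping.single {} 1)"

text \<open>List positions start at \<open>0\<close>, tuple positions at \<open>1\<close>: the tuple \<open>T\<^sub>k\<close> is \<open>omit (k - 1) T\<close>.\<close>

definition omit :: "nat \<Rightarrow> 'a list \<Rightarrow> 'a list" where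
  "omit k T = take k T @ drop (Suc k) T"

definition bdry :: "nat list \<Rightarrow> 'r::comm_ring_1 ext" where
  "bdry T = (\<Sum>k<length T. smul ((-1) ^ k) (mon (omit k T)))"


section \<open>The Aomoto complex of the general position arrangement\<close>

text \<open>
  The quotient of the exterior algebra by the elements of degree \<open>> l\<close> is represented by the
  elements of degree \<open>\<le> l\<close>; \<open>proj l\<close> is the quotient map.
\<close>

definition proj :: "nat \<Rightarrow> 'r::comm_ring_1 ext \<Rightarrow> 'r ext" where
  "proj l x = Poly_Mapping.mapp (\<lambda>I c. if card I \<le> l then c else 0) x"

definition os_mult :: "nat \<Rightarrow> 'r::comm_ring_1 ext \<Rightarrow> 'r ext \<Rightarrow> 'r ext" where
  "os_mult l x y = proj l (wedge x y)"

definition os_term :: "nat \<Rightarrow> nat \<Rightarrow> nat \<Rightarrow> cpoly ext set" where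
  "os_term n l p = {\<eta>.
     (\<forall>I\<in>Poly_Mapping.keys \<eta>. I \<subseteq> {1..n} \<and> card I = p \<and> card I \<le> l) \<and>
     (\<forall>I. Poly_Mapping.lookup \<eta> I \<in> poly_ring n)}"

definition a_y :: "nat \<Rightarrow> cpoly ext" where
  "a_y n = (\<Sum>j\<in>{1..n}. smul (var j) (gen j))"

text \<open>
  Cochain homomorphisms of the complex of \<open>R\<close>-modules with terms \<open>os_term n l p\<close> and differential
  left multiplication by \<open>a_y\<close>; the terms in negative degrees are zero.
\<close>

definition cochain_hom :: "nat \<Rightarrow> nat \<Rightarrow> (nat \<Rightarrow> cpoly ext \<Rightarrow> cpoly ext) \<Rightarrow> bool" where
  "cochain_hom n l F \<longleftrightarrow> (\<forall>p.
     (\<forall>\<eta>\<in>os_term n l p. F p \<eta> \<in> os_term n l p) \<and>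
     (\<forall>\<eta>\<in>os_term n l p. \<forall>\<xi>\<in>os_term n l p. F p (\<eta> + \<xi>) = F p \<eta> + F p \<xi>) \<and>
     (\<forall>r\<in>poly_ring n. \<forall>\<eta>\<in>os_term n l p. F p (smul r \<eta>) = smul r (F p \<eta>)) \<and>
     (\<forall>\<eta>\<in>os_term n l p. F (p + 1) (os_mult l (a_y n) \<eta>) = os_mult l (a_y n) (F p \<eta>)))"


section \<open>The endomorphisms \<open>\<omega>\<^sub>S\<close>\<close>

text \<open>
  The value on \<open>a\<^sub>T\<close> for a tuple \<open>T\<close> of \<open>p\<close> distinct indices. With \<open>card S = q + 1\<close>, the condition
  \<open>p = q\<close> reads \<open>card S = p + 1\<close> and \<open>p = q + 1\<close> reads \<open>card S = p\<close>. Where the formulas refer to a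
  \<open>j\<close> or a \<open>k\<close> with a certain property, at most one exists, and the sum over all of them is
  that single term, or \<open>0\<close> if there is none.
\<close>

definition omega_tuple :: "nat \<Rightarrow> nat \<Rightarrow> nat set \<Rightarrow> nat list \<Rightarrow> cpoly ext" where
  "omega_tuple n l S T = (let p = length T in
     if n + 1 \<notin> S then
       if card S = p + 1 then
         (\<Sum>j | j \<in> {1..n} \<and> S = set (j # T). smul (var j) (proj l (bdry (j # T))))
       else if card S = p \<and> S = set T then os_mult l (a_y n) (proj l (bdry T))
       else 0
     else
       if card S = p + 1 then
         if S = set T \<union> {n + 1} then
           smul (- (\<Sum>j\<in>{1..n} - set T. var j)) (proj l (mon T))
         else
           (\<Sum>(j, k) | j \<in> {1..n} \<and> k < p \<and> S = set (j # omit k T) \<union> {n + 1} \<and> j \<notin> set T.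
              smul ((-1) ^ k * var j) (proj l (mon (j # omit k T))))
       else if card S = p then
         (\<Sum>k | k < p \<and> S = set (omit k T) \<union> {n + 1}.
            smul ((-1) ^ (k + 1)) (os_mult l (a_y n) (proj l (mon (omit k T)))))
       else 0)"

text \<open>
  The \<open>R\<close>-linear extension from the basis of increasing monomials in degree \<open>p\<close>. The formulas then
  hold on all tuples of distinct indices: see \<open>omega_mon\<close> below.
\<close>

definition omega :: "nat \<Rightarrow> nat \<Rightarrow> nat set \<Rightarrow> nat \<Rightarrow> cpoly ext \<Rightarrow> cpoly ext" where
  "omega n l S p \<eta> = (\<Sum>I | I \<subseteq> {1..n} \<and> card I = p.
     smul (Poly_Mapping.lookup \<eta> I) (omega_tuple n l S (sorted_list_of_set I)))"


section \<open>Consistency of the definitions\<close>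

lemma lookup_smul [simp]: "Poly_Mapping.lookup (smul r x) I = r * Poly_Mapping.lookup x I"
  unfolding smul_def by (transfer) (auto simp: when_def)

lemma lookup_proj:
  "Poly_Mapping.lookup (proj l x) I = (if card I \<le> l then Poly_Mapping.lookup x I else 0)"
  unfolding proj_def by (auto simp: lookup_mapp when_def in_keys_iff)

lemma smul_single [simp]: "smul r (Poly_Mapping.single I c) = Poly_Mapping.single I (r * c)"
  by (rule poly_mapping_eqI) (simp add: lookup_single when_def)

lemma smul_smul: "smul r (smul s x) = smul (r * s) x"
  by (rule poly_mapping_eqI) (simp add: mult.assoc)

lemma smul_sum: "smul r (sum f A) = (\<Sum>i\<in>A. smul r (f i))"
  by (rule poly_mapping_eqI) (simp add: lookup_sum sum_distrib_left)

lemma smul_0 [simp]: "smul r 0 = 0" "smul 0 x = 0"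
  by (rule poly_mapping_eqI, simp)+

lemma smul_1 [simp]: "smul 1 x = x"
  by (rule poly_mapping_eqI) simp

lemma proj_smul: "proj l (smul r x) = smul r (proj l x)"
  by (rule poly_mapping_eqI) (simp add: lookup_proj)

lemma proj_sum: "proj l (sum f A) = (\<Sum>i\<in>A. proj l (f i))"
  by (rule poly_mapping_eqI) (simp add: lookup_proj lookup_sum)

lemma proj_single:
  "proj l (Poly_Mapping.single I c) = (if card I \<le> l then Poly_Mapping.single I c else 0)"
  by (rule poly_mapping_eqI) (simp add: lookup_proj lookup_single when_def)

lemma proj_eq_0_iff: "proj l x = 0 \<longleftrightarrow> (\<forall>I\<in>Poly_Mapping.keys x. l < card I)"
  unfolding poly_mapping_eq_iff fun_eq_iff lookup_proj in_keys_iff Ball_def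
  by (simp add: not_le[symmetric]) blast

lemma single_sum: "Poly_Mapping.single k (sum f A) = (\<Sum>i\<in>A. Poly_Mapping.single k (f i))"
  by (induction A rule: infinite_finite_induct) (simp_all add: single_add)

lemma wedge_superset:
  assumes "finite A" "finite B" "Poly_Mapping.keys x \<subseteq> A" "Poly_Mapping.keys y \<subseteq> B"
  shows "wedge x y = (\<Sum>I\<in>A. \<Sum>J\<in>B. Poly_Mapping.single (I \<union> J)
    (koszul I J * (Poly_Mapping.lookup x I * Poly_Mapping.lookup y J)))"
  unfolding wedge_def
proof (rule sum.mono_neutral_cong_left)
  fix I assume "I \<in> Poly_Mapping.keys x"
  show "(\<Sum>J\<in>Poly_Mapping.keys y. Poly_Mapping.single (I \<union> J)
      (koszul I J * (Poly_Mapping.lookup x I * Poly_Mapping.lookup y J)))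
    = (\<Sum>J\<in>B. Poly_Mapping.single (I \<union> J)
      (koszul I J * (Poly_Mapping.lookup x I * Poly_Mapping.lookup y J)))"
    by (rule sum.mono_neutral_left) (use assms in \<open>auto simp: in_keys_iff\<close>)
qed (use assms in \<open>auto simp: in_keys_iff\<close>)

lemma wedge_single:
  "wedge (Poly_Mapping.single I a) (Poly_Mapping.single J b)
   = Poly_Mapping.single (I \<union> J) (koszul I J * (a * b))"
  by (subst wedge_superset[of "{I}" "{J}"]) (auto split: if_splits)

lemma wedge_sum_left: 
  assumes "finite A"
  shows "wedge (sum f A) y = (\<Sum>i\<in>A. wedge (f i) y)"
proof -
  define K where "K = (\<Union>i\<in>A. Poly_Mapping.keys (f i))"
  have K: "finite K" unfolding K_def using assms by auto
  have "wedge (sum f A) y = (\<Sum>I\<in>K. \<Sum>J\<in>Poly_Mapping.keys y. \<Sum>i\<in>A. Poly_Mapping.single (I \<union> J)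
    (koszul I J * (Poly_Mapping.lookup (f i) I * Poly_Mapping.lookup y J)))"
    by (subst wedge_superset[OF K finite_keys _ order_refl])
       (auto simp: K_def lookup_sum sum_distrib_left sum_distrib_right single_sum
          dest: keys_sum[THEN subsetD])
  also have "\<dots> = (\<Sum>i\<in>A. \<Sum>I\<in>K. \<Sum>J\<in>Poly_Mapping.keys y. Poly_Mapping.single (I \<union> J)
    (koszul I J * (Poly_Mapping.lookup (f i) I * Poly_Mapping.lookup y J)))"
    by (rule trans[OF sum.cong[OF refl sum.swap] sum.swap])
  also have "\<dots> = (\<Sum>i\<in>A. wedge (f i) y)"
    by (rule sum.cong[OF refl], rule wedge_superset[symmetric]) (use K in \<open>auto simp: K_def\<close>)
  finally show ?thesis .
qed

lemma wedge_sum_right: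
  assumes "finite A"
  shows "wedge y (sum f A) = (\<Sum>i\<in>A. wedge y (f i))"
proof -
  define K where "K = (\<Union>i\<in>A. Poly_Mapping.keys (f i))"
  have K: "finite K" unfolding K_def using assms by auto
  have "wedge y (sum f A) = (\<Sum>J\<in>Poly_Mapping.keys y. \<Sum>I\<in>K. \<Sum>i\<in>A. Poly_Mapping.single (J \<union> I)
    (koszul J I * (Poly_Mapping.lookup y J * Poly_Mapping.lookup (f i) I)))"
    by (subst wedge_superset[OF finite_keys K order_refl])
       (auto simp: K_def lookup_sum sum_distrib_left sum_distrib_right single_sum
          dest: keys_sum[THEN subsetD])
  also have "\<dots> = (\<Sum>i\<in>A. \<Sum>J\<in>Poly_Mapping.keys y. \<Sum>I\<in>K. Poly_Mapping.single (J \<union> I)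
    (koszul J I * (Poly_Mapping.lookup y J * Poly_Mapping.lookup (f i) I)))"
    by (rule trans[OF sum.cong[OF refl sum.swap] sum.swap])
  also have "\<dots> = (\<Sum>i\<in>A. wedge y (f i))"
    by (rule sum.cong[OF refl], rule wedge_superset[symmetric]) (use K in \<open>auto simp: K_def\<close>)
  finally show ?thesis .
qed

lemma sum_single_keys:
  "(\<Sum>I\<in>Poly_Mapping.keys x. Poly_Mapping.single I (Poly_Mapping.lookup x I)) = x"
  by (rule poly_mapping_eqI)
     (auto simp: lookup_sum lookup_single when_def sum.delta in_keys_iff)

lemma koszul_cocycle:
  assumes "finite I" "finite J" "finite K"
  shows "koszul I J * koszul (I \<union> J) K = (koszul J K * koszul I (J \<union> K) :: 'r::comm_ring_1)"
proof (cases "I \<inter> J = {} \<and> I \<inter> K = {} \<and> J \<inter> K = {}")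
  case True
  let ?inv = "\<lambda>A B. {(i, j). i \<in> A \<and> j \<in> B \<and> j < (i::nat)}"
  have fin: "finite (?inv A B)" if "finite A" "finite B" for A B
    by (rule finite_subset[of _ "A \<times> B"]) (use that in auto)
  have "?inv (I \<union> J) K = ?inv I K \<union> ?inv J K" "?inv I (J \<union> K) = ?inv I J \<union> ?inv I K"
    by auto
  moreover have "?inv I K \<inter> ?inv J K = {}" "?inv I J \<inter> ?inv I K = {}"
    using True by auto
  ultimately have "card (?inv (I \<union> J) K) = card (?inv I K) + card (?inv J K)"
    "card (?inv I (J \<union> K)) = card (?inv I J) + card (?inv I K)"
    by (simp_all add: card_Un_disjoint fin assms)
  with True show ?thesis
    by (simp add: koszul_def Int_Un_distrib Int_Un_distrib2 power_add algebra_simps)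
qed (auto simp: koszul_def Int_Un_distrib Int_Un_distrib2)

lemma wedge_assoc:
  assumes "\<forall>I\<in>Poly_Mapping.keys x. finite I" "\<forall>I\<in>Poly_Mapping.keys y. finite I"
    "\<forall>I\<in>Poly_Mapping.keys z. finite I"
  shows "wedge (wedge x y) z = wedge x (wedge y z)"
proof -
  let ?s = "\<lambda>x I. Poly_Mapping.single I (Poly_Mapping.lookup x I)"
  have "wedge (wedge (\<Sum>I\<in>Poly_Mapping.keys x. ?s x I) (\<Sum>I\<in>Poly_Mapping.keys y. ?s y I))
      (\<Sum>I\<in>Poly_Mapping.keys z. ?s z I)
    = wedge (\<Sum>I\<in>Poly_Mapping.keys x. ?s x I)
      (wedge (\<Sum>I\<in>Poly_Mapping.keys y. ?s y I) (\<Sum>I\<in>Poly_Mapping.keys z. ?s z I))"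
    unfolding wedge_sum_left[OF finite_keys] wedge_sum_right[OF finite_keys] wedge_single
  proof (intro sum.cong[OF refl])
    fix I J K assume "I \<in> Poly_Mapping.keys x" "J \<in> Poly_Mapping.keys y" "K \<in> Poly_Mapping.keys z"
    with assms have "finite I" "finite J" "finite K" by auto
    note * = koszul_cocycle[OF this, where 'r = 'a]
    have "koszul (I \<union> J) K * (koszul I J * (a * b) * c)
        = koszul I (J \<union> K) * (a * (koszul J K * (b * c)))" for a b c :: 'a
    proof -
      have "koszul (I \<union> J) K * (koszul I J * (a * b) * c)
          = (koszul I J * koszul (I \<union> J) K) * (a * b * c)"
        by (simp only: mult_ac)
      also have "\<dots> = koszul I (J \<union> K) * (a * (koszul J K * (b * c)))"
        unfolding * by (simp only: mult_ac)
      finally show ?thesis .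
    qed
    then show "Poly_Mapping.single (I \<union> J \<union> K) (koszul (I \<union> J) K *
        (koszul I J * (Poly_Mapping.lookup x I * Poly_Mapping.lookup y J) * Poly_Mapping.lookup z K))
      = Poly_Mapping.single (I \<union> (J \<union> K)) (koszul I (J \<union> K) *
        (Poly_Mapping.lookup x I * (koszul J K * (Poly_Mapping.lookup y J * Poly_Mapping.lookup z K))))"
      by (simp only: Un_assoc)
  qed
  then show ?thesis unfolding sum_single_keys .
qed

lemma wedge_gen_self: "wedge (gen i) (gen i) = 0"
  by (simp add: gen_def wedge_single koszul_def)

lemma koszul_singleton:
  "i \<notin> J \<Longrightarrow> koszul {i} J = (-1) ^ card {j\<in>J. j < i}"
proof -
  assume "i \<notin> J"
  have "{(i', j). i' \<in> {i} \<and> j \<in> J \<and> j < i'} = Pair i ` {j\<in>J. j < i}" by auto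
  with \<open>i \<notin> J\<close> show ?thesis by (simp add: koszul_def card_image inj_on_def)
qed

lemma wedge_gen_anticommute: "wedge (gen i) (gen j) = - wedge (gen j) (gen i)"
proof -
  have "{x. x = a \<and> x < b} = (if a < b then {a} else {})" for a b :: nat by auto
  then show ?thesis
  by (cases i j rule: linorder_cases)
     (auto simp: wedge_gen_self, auto simp: gen_def wedge_single koszul_singleton insert_commute single_uminus)
qed

lemma proj_wedge:
  assumes "\<forall>I\<in>Poly_Mapping.keys x. finite I" "\<forall>I\<in>Poly_Mapping.keys y. finite I"
  shows "proj l (wedge (proj l x) (proj l y)) = proj l (wedge x y)"
proof -
  have *: "proj l (wedge u v) = (\<Sum>I\<in>Poly_Mapping.keys x. \<Sum>J\<in>Poly_Mapping.keys y.
      proj l (Poly_Mapping.single (I \<union> J)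
        (koszul I J * (Poly_Mapping.lookup u I * Poly_Mapping.lookup v J))))"
    if "Poly_Mapping.keys u \<subseteq> Poly_Mapping.keys x" "Poly_Mapping.keys v \<subseteq> Poly_Mapping.keys y" for u v
    by (subst wedge_superset[OF _ _ that]) (simp_all add: proj_sum)
  have k: "Poly_Mapping.keys (proj l z) \<subseteq> Poly_Mapping.keys z" for z :: "'a ext"
    by (auto simp: in_keys_iff lookup_proj split: if_splits)
  have "proj l (Poly_Mapping.single (I \<union> J)
        (koszul I J * (Poly_Mapping.lookup (proj l x) I * Poly_Mapping.lookup (proj l y) J)))
      = proj l (Poly_Mapping.single (I \<union> J)
        (koszul I J * (Poly_Mapping.lookup x I * Poly_Mapping.lookup y J)))"
    if "I \<in> Poly_Mapping.keys x" "J \<in> Poly_Mapping.keys y" for I J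
  proof -
    have "finite (I \<union> J)" using that assms by auto
    then have "card I \<le> card (I \<union> J)" "card J \<le> card (I \<union> J)" by (auto intro: card_mono)
    then show ?thesis by (auto simp: proj_single lookup_proj)
  qed
  then show ?thesis unfolding *[OF k k] *[OF order_refl order_refl] by (simp cong: sum.cong)
qed

text \<open>The sign of the permutation that sorts a tuple.\<close>

primrec tsign :: "nat list \<Rightarrow> 'r::comm_ring_1" where
  "tsign [] = 1"
| "tsign (i # T) = (-1) ^ card {j\<in>set T. j < i} * tsign T"

lemma mon_eq_single: "distinct T \<Longrightarrow> mon T = Poly_Mapping.single (set T) (tsign T)"
proof (induction T)
  case (Cons i T)
  have "mon (i # T) = wedge (gen i) (mon T :: 'a ext)" by (simp add: mon_def)
  with Cons show ?case by (simp add: gen_def wedge_single koszul_singleton)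
qed (simp add: mon_def)

lemma tsign_sorted: "sorted T \<Longrightarrow> tsign T = 1"
proof (induction T)
  case (Cons i T)
  then have "{j\<in>set T. j < i} = {}" by auto
  with Cons show ?case by (simp del: Collect_empty_eq)
qed simp

lemma mon_sorted_list_of_set:
  "finite I \<Longrightarrow> mon (sorted_list_of_set I) = Poly_Mapping.single I 1"
  by (simp add: mon_eq_single tsign_sorted)

lemma omit_simps [simp]:
  "omit 0 (i # T) = T" "omit (Suc k) (i # T) = i # omit k T"
  by (simp_all add: omit_def)

lemma set_omit: "distinct T \<Longrightarrow> k < length T \<Longrightarrow> set (omit k T) = set T - {T ! k}"
proof (induction T arbitrary: k)
  case (Cons i T) then show ?case by (cases k) auto
qed simp

lemma distinct_omit: "distinct T \<Longrightarrow> distinct (omit k T)"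
  by (simp add: omit_def set_take_disj_set_drop_if_distinct)

lemma tsign_omit:
  assumes "distinct T" "k < length T"
  shows "(-1) ^ k * tsign (omit k T)
    = (-1) ^ card {j\<in>set T. j < T ! k} * (tsign T :: 'r::comm_ring_1)"
  using assms
proof (induction T arbitrary: k)
  case (Cons i T)
  show ?case
  proof (cases k)
    case 0
    have "{j\<in>set (i # T). j < i} = {j\<in>set T. j < i}" by auto
    then show ?thesis using 0 by (simp add: mult.assoc[symmetric] power_add[symmetric])
  next
    case (Suc m)
    define t where "t = T ! m"
    have m: "m < length T" and d: "distinct T" and i: "i \<notin> set T" using Cons.prems Suc by auto
    then have t: "t \<in> set T" "t \<noteq> i" by (auto simp: t_def)
    have IH: "(-1) ^ m * tsign (omit m T) = (-1) ^ card {j\<in>set T. j < t} * (tsign T :: 'r)"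
      using Cons.IH[OF d m] by (simp add: t_def)
    have A: "(-1::'r) ^ card {j\<in>set T - {t}. j < i} * (- 1)
        = (-1) ^ card {j\<in>set (i # T). j < t} * (-1) ^ card {j\<in>set T. j < t}
            * (-1) ^ card {j\<in>set T. j < i}"
    proof (cases "t < i")
      case True
      then have "{j\<in>set T. j < i} = insert t {j\<in>set T - {t}. j < i}"
        "{j\<in>set (i # T). j < t} = {j\<in>set T. j < t}" using t by auto
      then show ?thesis by (simp add: power_add[symmetric])
    next
      case False
      then have "{j\<in>set T. j < i} = {j\<in>set T - {t}. j < i}"
        "{j\<in>set (i # T). j < t} = insert i {j\<in>set T. j < t}" using t by auto
      moreover have "i \<notin> {j\<in>set T. j < t}" using i by auto
      ultimately show ?thesis by (simp add: power_add[symmetric] mult.assoc[symmetric])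
    qed
    have "(-1) ^ k * tsign (omit k (i # T))
        = ((-1::'r) ^ card {j\<in>set T - {t}. j < i} * (- 1)) * ((-1) ^ m * tsign (omit m T))"
      by (simp add: Suc set_omit[OF d m] t_def)
    also have "\<dots> = (-1) ^ card {j\<in>set (i # T). j < t} * ((-1) ^ card {j\<in>set T. j < t}
       * (-1) ^ card {j\<in>set T. j < t}) * ((-1) ^ card {j\<in>set T. j < i} * tsign T)"
      unfolding A IH by (simp only: mult_ac)
    also have "(-1) ^ card {j\<in>set T. j < t} * (-1) ^ card {j\<in>set T. j < t} = (1::'r)"
      by (simp add: power_add[symmetric])
    finally show ?thesis by (simp add: Suc t_def)
  qed
qed simp

lemma wedge_smul_right: "wedge x (smul r y) = smul r (wedge x y)"
proof -
  have "Poly_Mapping.keys (smul r y) \<subseteq> Poly_Mapping.keys y" by (auto simp: in_keys_iff)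
  from wedge_superset[OF finite_keys finite_keys order_refl this] show ?thesis
    by (simp add: wedge_def smul_sum mult_ac)
qed

lemma os_mult_smul: "os_mult l x (smul r y) = smul r (os_mult l x y)"
  by (simp add: os_mult_def wedge_smul_right proj_smul)

definition contr :: "nat set \<Rightarrow> nat \<Rightarrow> 'r::comm_ring_1 ext" where
  "contr I i = Poly_Mapping.single (I - {i}) ((-1) ^ card {j\<in>I. j < i})"

lemma mon_omit:
  assumes "distinct T" "k < length T"
  shows "smul ((-1) ^ k) (mon (omit k T)) = smul (tsign T) (contr (set T) (T ! k))"
  using tsign_omit[OF assms, where 'r = 'a]
  by (simp add: mon_eq_single distinct_omit assms set_omit contr_def mult.commute)

lemma mon_Cons_omit:
  assumes "distinct T" "k < length T"
  shows "smul ((-1) ^ k) (mon (j # omit k T)) = smul (tsign T) (wedge (gen j) (contr (set T) (T ! k)))"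
  using mon_omit[OF assms, where 'a = 'a]
  by (simp add: mon_def wedge_smul_right[symmetric])

lemma bij_nth: "distinct T \<Longrightarrow> bij_betw ((!) T) {..<length T} (set T)"
  by (simp add: bij_betw_def inj_on_nth set_conv_nth image_def) blast

lemma bdry_contr:
  assumes "distinct T"
  shows "bdry T = smul (tsign T) (\<Sum>i\<in>set T. contr (set T) i)"
  unfolding bdry_def smul_sum
  using sum.reindex_bij_betw[OF bij_nth[OF assms], of "\<lambda>i. smul (tsign T) (contr (set T) i)"]
  by (simp add: mon_omit assms)

lemma omega_tuple_perm:
  assumes d: "distinct T" "distinct L" and s: "set T = set L" and sgn: "tsign L = (1::cpoly)"
  shows "omega_tuple n l S T = smul (tsign T) (omega_tuple n l S L)"
proof -
  have len: "length T = length L" using d s by (metis distinct_card)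
  have m: "mon T = smul (tsign T) (mon L :: cpoly ext)"
    by (simp add: mon_eq_single d s sgn)
  have b: "bdry T = smul (tsign T) (bdry L :: cpoly ext)"
    by (simp add: bdry_contr d s sgn smul_smul)
  have b1: "bdry (j # T) = smul (tsign T) (bdry (j # L) :: cpoly ext)" if "j \<notin> set L" for j
    using that by (simp add: bdry_contr d s sgn smul_smul mult.commute)
  have A: "(\<Sum>j | j \<in> {1..n} \<and> S = set (j # T). smul (var j) (proj l (bdry (j # T))))
    = smul (tsign T) (\<Sum>j | j \<in> {1..n} \<and> S = set (j # L). smul (var j) (proj l (bdry (j # L))))"
    if "card S = length L + 1" unfolding smul_sum
  proof (rule sum.cong)
    fix j assume "j \<in> {j. j \<in> {1..n} \<and> S = set (j # L)}"
    with that have "j \<notin> set L" using d by (auto simp: insert_absorb distinct_card)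
    then show "smul (var j) (proj l (bdry (j # T)))
      = smul (tsign T) (smul (var j) (proj l (bdry (j # L))))"
      by (simp add: b1 proj_smul smul_smul mult.commute)
  qed (use s in auto)
  have B: "(\<Sum>(j, k) | j \<in> {1..n} \<and> k < length M \<and> S = set (j # omit k M) \<union> {n + 1} \<and> j \<notin> set M.
      smul ((-1) ^ k * var j) (proj l (mon (j # omit k M))))
    = smul (tsign M) (\<Sum>(j, i) | j \<in> {1..n} \<and> i \<in> set M \<and> S = insert j (set M - {i}) \<union> {n + 1} \<and> j \<notin> set M.
        smul (var j) (proj l (wedge (gen j) (contr (set M) i))))" (is "?l = ?r") if "distinct M" for M
  proof -
    let ?A = "{(j, k). j \<in> {1..n} \<and> k < length M \<and> S = set (j # omit k M) \<union> {n + 1} \<and> j \<notin> set M}"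
    let ?B = "{(j, i). j \<in> {1..n} \<and> i \<in> set M \<and> S = insert j (set M - {i}) \<union> {n + 1} \<and> j \<notin> set M}"
    have bij: "bij_betw (\<lambda>(j, k). (j, M ! k)) ?A ?B"
      unfolding bij_betw_def
    proof
      show "inj_on (\<lambda>(j, k). (j, M ! k)) ?A"
        using that by (auto simp: inj_on_def nth_eq_iff_index_eq)
      show "(\<lambda>(j, k). (j, M ! k)) ` ?A = ?B"
      proof (intro equalityI subsetI)
        fix z assume "z \<in> ?B"
        then obtain j i where z: "z = (j, i)" "(j, i) \<in> ?B" by auto
        then obtain k where k: "k < length M" "i = M ! k" by (auto simp: in_set_conv_nth)
        with z that have "(j, k) \<in> ?A" by (auto simp: set_omit)
        then show "z \<in> (\<lambda>(j, k). (j, M ! k)) ` ?A"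
          using z k by (auto intro!: image_eqI[of _ _ "(j, k)"])
      qed (use that in \<open>auto simp: set_omit\<close>)
    qed
    have "?l = (\<Sum>(j, k)\<in>?A. smul (tsign M) (smul (var j) (proj l (wedge (gen j) (contr (set M) (M ! k))))))"
    proof (rule sum.cong[OF refl], clarify)
      fix j k assume "k < length M"
      from arg_cong[OF mon_Cons_omit[OF that this, where 'a = cpoly, of j], of "\<lambda>x. smul (var j) (proj l x)"]
      show "smul ((-1) ^ k * var j) (proj l (mon (j # omit k M)))
        = smul (tsign M) (smul (var j) (proj l (wedge (gen j) (contr (set M) (M ! k)))))"
        by (simp add: proj_smul smul_smul mult.commute)
    qed
    also have "\<dots> = ?r"
      unfolding smul_sum
      using sum.reindex_bij_betw[OF bij, of "\<lambda>(j, i). smul (tsign M) (smul (var j) (proj l (wedge (gen j) (contr (set M) i))))"]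
      by (simp add: case_prod_unfold)
    finally show ?thesis .
  qed
  have C: "(\<Sum>k | k < length M \<and> S = set (omit k M) \<union> {n + 1}.
      smul ((-1) ^ (k + 1)) (os_mult l (a_y n) (proj l (mon (omit k M)))))
    = smul (tsign M) (\<Sum>i | i \<in> set M \<and> S = (set M - {i}) \<union> {n + 1}.
        smul (-1) (os_mult l (a_y n) (proj l (contr (set M) i))))" (is "?l = ?r") if "distinct M" for M
  proof -
    let ?A = "{k. k < length M \<and> S = set (omit k M) \<union> {n + 1}}"
    let ?B = "{i. i \<in> set M \<and> S = (set M - {i}) \<union> {n + 1}}"
    have bij: "bij_betw ((!) M) ?A ?B"
      unfolding bij_betw_def
    proof
      show "inj_on ((!) M) ?A"
        using that by (auto simp: inj_on_def nth_eq_iff_index_eq)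
      show "(!) M ` ?A = ?B"
        using that by (auto simp: set_omit in_set_conv_nth[of _ M])
    qed
    have "?l = (\<Sum>k\<in>?A. smul (tsign M) (smul (-1) (os_mult l (a_y n) (proj l (contr (set M) (M ! k))))))"
    proof (rule sum.cong[OF refl], clarify)
      fix k assume "k < length M"
      from arg_cong[OF mon_omit[OF that this, where 'a = cpoly],
          of "\<lambda>x. smul (-1) (os_mult l (a_y n) (proj l x))"]
      show "smul ((-1) ^ (k + 1)) (os_mult l (a_y n) (proj l (mon (omit k M))))
        = smul (tsign M) (smul (-1) (os_mult l (a_y n) (proj l (contr (set M) (M ! k)))))"
        by (simp add: proj_smul smul_smul os_mult_smul mult.commute)
    qed
    also have "\<dots> = ?r"
      unfolding smul_sum
      using sum.reindex_bij_betw[OF bij, of "\<lambda>i. smul (tsign M) (smul (-1) (os_mult l (a_y n) (proj l (contr (set M) i))))"]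
      by simp
    finally show ?thesis .
  qed
  show ?thesis
  proof (cases "card S = length L + 1")
    case True
    show ?thesis
      unfolding omega_tuple_def Let_def B[OF d(1), unfolded len] B[OF d(2)] len A[OF True]
      by (simp add: True s sgn m proj_smul smul_smul mult.commute del: list.set)
  next
    case False
    then show ?thesis
      unfolding omega_tuple_def Let_def C[OF d(1), unfolded len] C[OF d(2)] len
      by (simp add: s sgn b proj_smul os_mult_smul)
  qed
qed

text \<open>Tuples longer than \<open>l\<close> are excluded because their \<open>a\<^sub>T\<close> is \<open>0\<close> in the quotient.\<close>

theorem omega_mon:
  assumes T: "distinct T" "set T \<subseteq> {1..n}" "length T \<le> l"
  shows "omega n l S (length T) (proj l (mon T)) = omega_tuple n l S T"
proof -
  have fin: "finite {I. I \<subseteq> {1..n} \<and> card I = length T}"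
    by (rule finite_subset[of _ "Pow {1..n}"]) auto
  have c: "card (set T) = length T" using T distinct_card by blast
  have "omega n l S (length T) (proj l (mon T))
    = (\<Sum>I | I \<subseteq> {1..n} \<and> card I = length T. if I = set T
        then smul (tsign T) (omega_tuple n l S (sorted_list_of_set I)) else 0)"
    unfolding omega_def using T
    by (intro sum.cong) (auto simp: lookup_proj mon_eq_single lookup_single when_def)
  also have "\<dots> = smul (tsign T) (omega_tuple n l S (sorted_list_of_set (set T)))"
    using fin T c by simp
  also have "\<dots> = omega_tuple n l S T"
    by (rule omega_tuple_perm[symmetric]) (auto simp: T tsign_sorted)
  finally show ?thesis .
qed

text \<open>The sums in \<open>omega_tuple\<close> have a single term whenever a suitable \<open>j\<close> or \<open>k\<close> exists.\<close>

lemma omega_tuple_bdry: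
  assumes "distinct T" "set T \<subseteq> {1..n}"
    and *: "n + 1 \<notin> S" "card S = length T + 1" "j \<in> {1..n}" "S = set (j # T)"
  shows "omega_tuple n l S T = smul (var j) (proj l (bdry (j # T)))"
proof -
  have "j \<notin> set T" using assms(1) *(2,4) by (auto simp: insert_absorb distinct_card)
  have "{i. i \<in> {1..n} \<and> S = set (i # T)} = {j}"
  proof (intro equalityI subsetI)
    fix i assume "i \<in> {i. i \<in> {1..n} \<and> S = set (i # T)}"
    then have "set (i # T) = S" by blast
    moreover have "j \<in> S" unfolding *(4) by simp
    ultimately have "j \<in> set (i # T)" by blast
    with \<open>j \<notin> set T\<close> show "i \<in> {j}" by simp
  next
    fix i assume "i \<in> {j}"
    then have "i = j" by blast
    show "i \<in> {i. i \<in> {1..n} \<and> S = set (i # T)}"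
      unfolding \<open>i = j\<close> using *(3,4) by blast
  qed
  then show ?thesis
    unfolding omega_tuple_def Let_def by (simp only: *(1,2) not_False_eq_True if_True) simp
qed

lemma omega_tuple_exchange:
  assumes "distinct T" "set T \<subseteq> {1..n}"
    and *: "card S = length T + 1" "j \<in> {1..n}" "j \<notin> set T" "k < length T"
      "S = set (j # omit k T) \<union> {n + 1}"
  shows "omega_tuple n l S T = smul ((-1) ^ k * var j) (proj l (mon (j # omit k T)))"
proof -
  have n: "n + 1 \<notin> set T" "T ! k \<in> set T" "j \<noteq> n + 1" using assms(2) *(2,4) by auto
  have inj: "m = k" if "m < length T" "T ! m = T ! k" for m
    using that *(4) assms(1) by (simp add: nth_eq_iff_index_eq)
  have "{(i, m). i \<in> {1..n} \<and> m < length T \<and> S = set (i # omit m T) \<union> {n + 1} \<and> i \<notin> set T}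
    = {(j, k)}" (is "?A = _")
  proof (intro equalityI subsetI)
    fix z assume "z \<in> ?A"
    then obtain i m where z: "z = (i, m)" "i \<in> {1..n}" "m < length T" "i \<notin> set T"
      "S = set (i # omit m T) \<union> {n + 1}" by auto
    have S: "S = insert j (set T - {T ! k}) \<union> {n + 1}"
      by (rule trans[OF *(5)]) (simp add: set_omit[OF assms(1) *(4)])
    have S': "S = insert i (set T - {T ! m}) \<union> {n + 1}"
      by (rule trans[OF z(5)]) (simp add: set_omit[OF assms(1) z(3)])
    have Tm: "T ! m \<in> set T" using z(3) by simp
    have "T ! m \<noteq> n + 1" "T ! m \<noteq> i" "i \<noteq> n + 1" using Tm n(1) z(2,4) by auto
    then have "i \<in> S" "T ! m \<notin> S" unfolding S' by blast+
    then have "i = j" "T ! m = T ! k" using z(4) Tm \<open>i \<noteq> n + 1\<close> unfolding S by blast+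
    then show "z \<in> {(j, k)}" using inj[OF z(3)] z(1) by simp
  qed (use *(2-5) in auto)
  moreover have "j \<in> S" "n + 1 \<in> S" unfolding *(5) by simp_all
  moreover from this have "S \<noteq> set T \<union> {n + 1}" using *(3) n by blast
  ultimately show ?thesis
    using *(1) by (simp add: omega_tuple_def del: list.set)
qed

lemma omega_tuple_omit:
  assumes "distinct T" "set T \<subseteq> {1..n}"
    and *: "card S = length T" "k < length T" "S = set (omit k T) \<union> {n + 1}"
  shows "omega_tuple n l S T
    = smul ((-1) ^ (k + 1)) (os_mult l (a_y n) (proj l (mon (omit k T))))"
proof -
  have n: "n + 1 \<notin> set T" using assms(2) by auto
  have "{m. m < length T \<and> S = set (omit m T) \<union> {n + 1}} = {k}" (is "?A = _")
  proof (intro equalityI subsetI)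
    fix m assume m: "m \<in> ?A"
    then have "m < length T" "set (omit k T) \<union> {n + 1} = set (omit m T) \<union> {n + 1}"
      using *(3) by blast+
    then have "set T - {T ! k} \<union> {n + 1} = set T - {T ! m} \<union> {n + 1}"
      by (simp only: set_omit assms *(2))
    moreover have "T ! m \<in> set T" using m by simp
    ultimately have "T ! m = T ! k"
      using n by (metis Diff_iff UnE UnI1 insertI1 singletonD)
    then show "m \<in> {k}" using m *(2) assms(1) by (simp add: nth_eq_iff_index_eq)
  qed (use *(2,3) in simp)
  moreover have "n + 1 \<in> S" unfolding *(3) by simp
  ultimately show ?thesis
    using *(1) by (simp add: omega_tuple_def)
qed

end

theory Submission
  imports Defs
begin

text \<open>
  Let \<open>card S = q + 1\<close>. Both cases of the definition have the common shape
  \<open>\<omega>\<^sub>S(\<eta>) = f(a\<^sub>y \<eta>) v\<close> in degree \<open>q\<close> and \<open>\<omega>\<^sub>S(\<eta>) = f(\<eta>) a\<^sub>y v\<close> in degree \<open>q + 1\<close>, for a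
  linear functional \<open>f\<close> on degree \<open>q + 1\<close> and an element \<open>v\<close> of degree \<open>q\<close> of the exterior algebra:
  if \<open>n + 1 \<notin> S\<close>, then \<open>f\<close> is the coefficient at \<open>S\<close> and \<open>v = \<partial>a\<^sub>S\<close>; if \<open>S = U \<union> {n + 1}\<close>, then
  \<open>f(x)\<close> is minus the coefficient of \<open>\<partial>x\<close> at \<open>U\<close> and \<open>v = a\<^sub>U\<close>. Any map of this shape commutes
  with \<open>a\<^sub>y\<close> because \<open>a\<^sub>y a\<^sub>y = 0\<close>.
\<close>

section \<open>Closure properties of the coefficient ring\<close>

lemma poly_ring_0 [simp]: "0 \<in> poly_ring n"
  by (simp add: poly_ring_def)

lemma poly_ring_1 [simp]: "1 \<in> poly_ring n"
  by (simp add: poly_ring_def)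

lemma poly_ring_uminus: "f \<in> poly_ring n \<Longrightarrow> - f \<in> poly_ring n"
  by (simp add: poly_ring_def)

lemma poly_ring_add: "f \<in> poly_ring n \<Longrightarrow> g \<in> poly_ring n \<Longrightarrow> f + g \<in> poly_ring n"
  unfolding poly_ring_def using Poly_Mapping.keys_add[of f g] by blast

lemma poly_ring_mult:
  assumes "f \<in> poly_ring n" "g \<in> poly_ring n"
  shows "f * g \<in> poly_ring n"
  unfolding poly_ring_def
proof (intro CollectI ballI)
  fix m assume "m \<in> Poly_Mapping.keys (f * g)"
  then obtain a b where "m = a + b" "a \<in> Poly_Mapping.keys f" "b \<in> Poly_Mapping.keys g"
    using keys_mult[of f g] by blast
  then show "Poly_Mapping.keys m \<subseteq> {1..n}"
    using assms Poly_Mapping.keys_add[of a b] unfolding poly_ring_def by blast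
qed

lemma poly_ring_sum: "(\<And>i. i \<in> A \<Longrightarrow> f i \<in> poly_ring n) \<Longrightarrow> sum f A \<in> poly_ring n"
  by (induction A rule: infinite_finite_induct) (simp_all add: poly_ring_add)

lemma poly_ring_neg1_power: "(-1) ^ k \<in> poly_ring n"
  by (cases "even k") (simp_all add: poly_ring_uminus)

lemma poly_ring_var: "j \<in> {1..n} \<Longrightarrow> var j \<in> poly_ring n"
  by (simp add: poly_ring_def var_def)

lemma poly_ring_koszul: "koszul I J \<in> poly_ring n"
  by (simp add: koszul_def poly_ring_neg1_power)

section \<open>Bilinearity and support of the wedge product\<close>

lemma smul_add_left: "smul (r + s) x = smul r x + smul s x"
  by (rule poly_mapping_eqI) (simp add: lookup_add distrib_right)

lemma smul_sum_left: "smul (sum f A) x = (\<Sum>i\<in>A. smul (f i) x)"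
  by (rule poly_mapping_eqI) (simp add: lookup_sum sum_distrib_right)

lemma wedge_0 [simp]: "wedge 0 x = 0" "wedge x 0 = 0"
  by (simp_all add: wedge_def)

lemma wedge_smul_left: "wedge (smul r x) y = smul r (wedge x y)"
proof -
  have "Poly_Mapping.keys (smul r x) \<subseteq> Poly_Mapping.keys x" by (auto simp: in_keys_iff)
  from wedge_superset[OF finite_keys finite_keys this order_refl, of y] show ?thesis
    by (simp add: wedge_def smul_sum mult_ac)
qed

lemma sum_smul_single:
  assumes "finite A" "Poly_Mapping.keys x \<subseteq> A"
  shows "(\<Sum>I\<in>A. smul (Poly_Mapping.lookup x I) (Poly_Mapping.single I 1)) = x"
proof -
  have "(\<Sum>I\<in>A. Poly_Mapping.single I (Poly_Mapping.lookup x I)) = x"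
    by (rule trans[OF sum.mono_neutral_right[OF assms] sum_single_keys]) (simp add: in_keys_iff)
  then show ?thesis by simp
qed

lemma keys_wedge:
  assumes "K \<in> Poly_Mapping.keys (wedge x y)"
  obtains I J where "I \<in> Poly_Mapping.keys x" "J \<in> Poly_Mapping.keys y" "I \<inter> J = {}" "K = I \<union> J"
proof -
  have "Poly_Mapping.lookup (wedge x y) K \<noteq> 0" using assms by (simp add: in_keys_iff)
  then obtain I where I: "I \<in> Poly_Mapping.keys x"
    "(\<Sum>J\<in>Poly_Mapping.keys y. Poly_Mapping.lookup (Poly_Mapping.single (I \<union> J)
       (koszul I J * (Poly_Mapping.lookup x I * Poly_Mapping.lookup y J))) K) \<noteq> 0"
    unfolding wedge_def lookup_sum by (rule sum.not_neutral_contains_not_neutral)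
  from I(2) obtain J where J: "J \<in> Poly_Mapping.keys y" "Poly_Mapping.lookup
       (Poly_Mapping.single (I \<union> J) (koszul I J * (Poly_Mapping.lookup x I * Poly_Mapping.lookup y J))) K \<noteq> 0"
    by (rule sum.not_neutral_contains_not_neutral)
  then have "I \<inter> J = {}" "K = I \<union> J"
    by (auto simp: lookup_single when_def koszul_def split: if_splits)
  with I(1) J(1) show thesis using that by blast
qed

section \<open>Signs for inserting and removing one index\<close>

lemma koszul_singleton_square:
  "i \<notin> J \<Longrightarrow> koszul {i} J * koszul {i} J = (1 :: 'r::comm_ring_1)"
  by (simp add: koszul_singleton power_add[symmetric])

lemma koszul_singleton_mem: "i \<in> J \<Longrightarrow> koszul {i} J = 0"
  by (simp add: koszul_def)

lemma koszul_singleton_insert: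
  assumes "finite W" "i \<notin> W" "j \<notin> W" "i \<noteq> j"
  shows "koszul {i} (insert j W) = (if j < i then - 1 else 1) * (koszul {i} W :: 'r::comm_ring_1)"
proof -
  have "{x \<in> insert j W. x < i} = (if j < i then insert j {x\<in>W. x < i} else {x\<in>W. x < i})"
    by auto
  then show ?thesis using assms by (simp add: koszul_singleton)
qed

text \<open>Exactly one of \<open>i < j\<close> and \<open>j < i\<close> holds, so exactly one of
  the two signs on the right changes when the other index is inserted. This is the anticommutation
  of multiplying by one generator and contracting with another.\<close>

lemma koszul_exchange:
  assumes "finite W" "i \<notin> W" "j \<notin> W" "i \<noteq> j"
  shows "koszul {j} W * koszul {i} W
    = - (koszul {i} (insert j W) * (koszul {j} (insert i W) :: 'r::comm_ring_1))"
  using assms by (cases i j rule: linorder_cases) (simp_all add: koszul_singleton_insert)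

lemma contr_koszul: "i \<in> I \<Longrightarrow> contr I i = Poly_Mapping.single (I - {i}) (koszul {i} (I - {i}))"
proof -
  have "{j \<in> I - {i}. j < i} = {j\<in>I. j < i}" by auto
  then show ?thesis by (simp add: contr_def koszul_singleton)
qed

section \<open>The element \<open>a_y\<close> and its square\<close>

lemma keys_a_y: "I \<in> Poly_Mapping.keys (a_y n) \<Longrightarrow> \<exists>j\<in>{1..n}. I = {j}"
proof -
  assume "I \<in> Poly_Mapping.keys (a_y n)"
  then have "(\<Sum>j\<in>{1..n}. Poly_Mapping.lookup (smul (var j) (gen j)) I) \<noteq> 0"
    by (simp add: in_keys_iff a_y_def lookup_sum)
  then obtain j where "j \<in> {1..n}" "Poly_Mapping.lookup (smul (var j) (gen j)) I \<noteq> 0"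
    by (rule sum.not_neutral_contains_not_neutral)
  then show ?thesis by (auto simp: gen_def lookup_single when_def split: if_splits)
qed

lemma lookup_a_y_poly_ring: "Poly_Mapping.lookup (a_y n) I \<in> poly_ring n"
  unfolding a_y_def lookup_sum
  by (rule poly_ring_sum) (auto simp: gen_def lookup_single when_def intro!: poly_ring_var)

lemma wedge_a_y_a_y: "wedge (a_y n) (a_y n) = 0"
proof -
  let ?X = "wedge (a_y n) (a_y n)"
  have X: "?X = (\<Sum>i\<in>{1..n}. \<Sum>j\<in>{1..n}. smul (var i * var j) (wedge (gen i) (gen j)))"
    unfolding a_y_def wedge_sum_left[OF finite_atLeastAtMost]
    unfolding wedge_sum_right[OF finite_atLeastAtMost]
    by (simp add: wedge_smul_left wedge_smul_right smul_smul smul_sum mult.commute)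
  also have "\<dots> = (\<Sum>j\<in>{1..n}. \<Sum>i\<in>{1..n}. smul (var i * var j) (wedge (gen i) (gen j)))"
    by (rule sum.swap)
  also have "\<dots> = (\<Sum>j\<in>{1..n}. \<Sum>i\<in>{1..n}. - smul (var j * var i) (wedge (gen j) (gen i)))"
  proof (intro sum.cong refl)
    fix i j
    show "smul (var i * var j) (wedge (gen i) (gen j)) = - smul (var j * var i) (wedge (gen j) (gen i))"
      by (subst wedge_gen_anticommute) (rule poly_mapping_eqI, simp add: mult.commute)
  qed
  also have "\<dots> = - ?X" unfolding X by (simp add: sum_negf)
  finally have X_neg: "?X = - ?X" .
  \<comment> \<open>Passing from X = -X to X = 0 cancels a 2. This is done in the complex
    coefficients, below both layers of finitely supported maps.\<close>
  have "Poly_Mapping.lookup (Poly_Mapping.lookup ?X I) m = 0" for I m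
  proof -
    have "Poly_Mapping.lookup (Poly_Mapping.lookup ?X I) m
        = - Poly_Mapping.lookup (Poly_Mapping.lookup ?X I) m"
      by (subst X_neg) simp
    then show ?thesis by simp
  qed
  then show ?thesis by (intro poly_mapping_eqI) simp
qed

lemma wedge_a_y_twice:
  assumes "\<forall>I\<in>Poly_Mapping.keys x. finite I"
  shows "wedge (a_y n) (wedge (a_y n) x) = 0"
proof -
  have fin: "\<forall>I\<in>Poly_Mapping.keys (a_y n). finite I" using keys_a_y by blast
  show ?thesis by (simp add: wedge_assoc[OF fin fin assms, symmetric] wedge_a_y_a_y)
qed

lemma lookup_wedge_a_y_single:
  "Poly_Mapping.lookup (wedge (a_y n) (Poly_Mapping.single I 1)) K
   = (\<Sum>j\<in>{1..n}. if insert j I = K then var j * koszul {j} I else 0)"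
  by (simp add: a_y_def wedge_sum_left wedge_smul_left gen_def wedge_single lookup_sum lookup_single
      when_def mult.commute)

section \<open>The truncated product and the terms of the complex\<close>

lemma proj_0 [simp]: "proj l 0 = 0"
  by (simp add: proj_eq_0_iff)

lemma proj_eq_self: "(\<And>I. I \<in> Poly_Mapping.keys x \<Longrightarrow> card I \<le> l) \<Longrightarrow> proj l x = x"
  by (rule poly_mapping_eqI) (metis lookup_proj in_keys_iff)

lemma os_mult_0 [simp]: "os_mult l x 0 = 0"
  by (simp add: os_mult_def)

text \<open>Since \<open>1 \<le> l\<close>, truncation fixes \<open>a_y n\<close>, so
  \<open>proj_wedge\<close> allows the inner truncation to be dropped and the claim reduces to the
  exterior algebra.\<close>

lemma os_mult_a_y_twice:
  assumes "1 \<le> l" "\<forall>I\<in>Poly_Mapping.keys x. finite I"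
  shows "os_mult l (a_y n) (os_mult l (a_y n) x) = 0"
proof -
  have fin: "\<forall>I\<in>Poly_Mapping.keys (a_y n). finite I" using keys_a_y by blast
  have fin': "\<forall>I\<in>Poly_Mapping.keys (wedge (a_y n) x). finite I"
    using fin assms(2) by (auto elim!: keys_wedge)
  have "proj l (a_y n) = a_y n"
    using keys_a_y[of _ n] assms(1) by (intro proj_eq_self) force
  then show ?thesis
    using proj_wedge[OF fin fin', of l] wedge_a_y_twice[OF assms(2), of n]
    by (simp add: os_mult_def)
qed

lemma os_term_finite_keys: "x \<in> os_term n l p \<Longrightarrow> \<forall>I\<in>Poly_Mapping.keys x. finite I"
  by (auto simp: os_term_def intro: finite_subset)

lemma os_term_0 [simp]: "0 \<in> os_term n l p"
  by (simp add: os_term_def)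

lemma os_term_smul:
  assumes "r \<in> poly_ring n" "x \<in> os_term n l p"
  shows "smul r x \<in> os_term n l p"
proof -
  have "Poly_Mapping.keys (smul r x) \<subseteq> Poly_Mapping.keys x" by (auto simp: in_keys_iff)
  then show ?thesis using assms by (auto simp: os_term_def intro: poly_ring_mult)
qed

lemma os_term_add: "x \<in> os_term n l p \<Longrightarrow> y \<in> os_term n l p \<Longrightarrow> x + y \<in> os_term n l p"
  using Poly_Mapping.keys_add[of x y] unfolding os_term_def
  by (simp add: lookup_add poly_ring_add) blast

lemma os_term_sum: "(\<And>i. i \<in> A \<Longrightarrow> f i \<in> os_term n l p) \<Longrightarrow> sum f A \<in> os_term n l p"
  by (induction A rule: infinite_finite_induct) (simp_all add: os_term_add)

lemma lookup_wedge_poly_ring: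
  assumes "\<And>I. Poly_Mapping.lookup x I \<in> poly_ring n" "\<And>I. Poly_Mapping.lookup y I \<in> poly_ring n"
  shows "Poly_Mapping.lookup (wedge x y) K \<in> poly_ring n"
  unfolding wedge_def lookup_sum lookup_single when_def
  by (auto intro!: poly_ring_sum poly_ring_mult poly_ring_koszul assms)

lemma keys_wedge_a_y:
  assumes "\<forall>I\<in>Poly_Mapping.keys x. I \<subseteq> {1..n} \<and> card I = p" "K \<in> Poly_Mapping.keys (wedge (a_y n) x)"
  shows "K \<subseteq> {1..n} \<and> card K = p + 1"
proof -
  from assms(2) obtain I J where IJ: "I \<in> Poly_Mapping.keys (a_y n)" "J \<in> Poly_Mapping.keys x"
    "I \<inter> J = {}" "K = I \<union> J" by (rule keys_wedge)
  then obtain j where "j \<in> {1..n}" "I = {j}" using keys_a_y by blast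
  moreover have "J \<subseteq> {1..n}" "card J = p" "finite J"
    using assms(1) IJ(2) by (auto intro: finite_subset)
  ultimately show ?thesis using IJ(3,4) by simp
qed

lemma os_mult_a_y_os_term:
  assumes "x \<in> os_term n l p"
  shows "os_mult l (a_y n) x \<in> os_term n l (p + 1)"
proof -
  have *: "\<forall>I\<in>Poly_Mapping.keys x. I \<subseteq> {1..n} \<and> card I = p" "\<And>I. Poly_Mapping.lookup x I \<in> poly_ring n"
    using assms by (auto simp: os_term_def)
  show ?thesis
    using keys_wedge_a_y[OF *(1)] lookup_wedge_poly_ring[OF lookup_a_y_poly_ring *(2)]
    unfolding os_term_def os_mult_def by (simp add: in_keys_iff lookup_proj Ball_def) metis
qed

lemma os_term_above: "l < p \<Longrightarrow> x \<in> os_term n l p \<Longrightarrow> x = 0"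
  by (force simp: os_term_def simp flip: keys_eq_empty)

text \<open>Below the top degree nothing is cut off. Thus the product in the complex can be traded
  for the untruncated one to which \<open>omega_functional\<close> is applied.\<close>

lemma os_mult_a_y_eq_wedge:
  assumes "x \<in> os_term n l p" "p + 1 \<le> l"
  shows "os_mult l (a_y n) x = wedge (a_y n) x"
proof -
  have *: "\<forall>I\<in>Poly_Mapping.keys x. I \<subseteq> {1..n} \<and> card I = p"
    using assms by (auto simp: os_term_def)
  show ?thesis
    using keys_wedge_a_y[OF *] assms(2) unfolding os_mult_def by (intro proj_eq_self) simp
qed

section \<open>The functional and the vector attached to \<open>S\<close>\<close>

text \<open>It lives on the untruncated exterior algebra: for \<open>card S = l + 1\<close> it has
  to read the degree \<open>l + 1\<close> part of a product with \<open>a_y\<close>, which is zero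
  in the quotient. The sum may run over all of \<open>{1..n}\<close> because
  \<open>koszul {i} U\<close> vanishes for \<open>i\<close> in \<open>U\<close>.\<close>

definition omega_functional :: "nat \<Rightarrow> nat set \<Rightarrow> cpoly ext \<Rightarrow> cpoly" where
  "omega_functional n S x =
     (if n + 1 \<notin> S then Poly_Mapping.lookup x S
      else - (\<Sum>i\<in>{1..n}. koszul {i} (S - {n + 1}) * Poly_Mapping.lookup x (insert i (S - {n + 1}))))"

text \<open>Writing the boundary through \<open>contr\<close> avoids ordering \<open>S\<close>; by
  \<open>bdry_contr\<close> a tuple with entries \<open>S\<close> has this boundary up to its
  sorting sign.\<close>

definition omega_vector :: "nat \<Rightarrow> nat set \<Rightarrow> cpoly ext" where
  "omega_vector n S =
     (if n + 1 \<notin> S then (\<Sum>i\<in>S. contr S i) else Poly_Mapping.single (S - {n + 1}) 1)"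

lemma omega_functional_0 [simp]: "omega_functional n S 0 = 0"
  by (simp add: omega_functional_def)

lemma omega_functional_smul: "omega_functional n S (smul r x) = r * omega_functional n S x"
  by (simp add: omega_functional_def sum_distrib_left mult_ac)

lemma omega_functional_add:
  "omega_functional n S (x + y) = omega_functional n S x + omega_functional n S y"
  by (simp add: omega_functional_def lookup_add distrib_left sum.distrib)

lemma omega_functional_sum:
  "omega_functional n S (sum f A) = (\<Sum>i\<in>A. omega_functional n S (f i))"
  by (induction A rule: infinite_finite_induct) (simp_all add: omega_functional_add)

lemma omega_functional_poly_ring:
  "(\<And>I. Poly_Mapping.lookup x I \<in> poly_ring n) \<Longrightarrow> omega_functional n S x \<in> poly_ring n"
  by (auto simp: omega_functional_def
      intro!: poly_ring_uminus poly_ring_sum poly_ring_mult poly_ring_koszul)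

lemma proj_omega_vector_os_term:
  assumes "S \<subseteq> {1..n + 1}" "card S = p + 1"
  shows "proj l (omega_vector n S) \<in> os_term n l p"
proof (cases "n + 1 \<in> S")
  case True
  have "finite S" using assms(1) by (rule finite_subset) simp
  then have "card (S - {n + 1}) = p" using True assms(2) by simp
  moreover have "S - {n + 1} \<subseteq> {1..n}" using assms(1) by auto
  ultimately show ?thesis using True
    by (auto simp: omega_vector_def proj_single os_term_def lookup_single when_def)
next
  case False
  have S: "S \<subseteq> {1..n}" using assms(1) False by (force simp: subset_iff le_Suc_eq)
  have "proj l (contr S i) \<in> os_term n l p" if "i \<in> S" for i
  proof -
    have "card (S - {i}) = p" using that assms(2) finite_subset[OF S] by simp
    moreover have "S - {i} \<subseteq> {1..n}" using S by auto
    ultimately show ?thesis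
      by (auto simp: contr_def proj_single os_term_def lookup_single when_def poly_ring_neg1_power
        split: if_splits)
  qed
  then show ?thesis using False by (simp add: omega_vector_def proj_sum os_term_sum)
qed

text \<open>For empty \<open>S\<close> the degree \<open>card S - 1\<close> of the vector would be
  -1, so this case is split off wherever that degree is used.\<close>

lemma proj_omega_vector_empty: "proj l (omega_vector n {}) = 0"
  by (simp add: omega_vector_def)

section \<open>The formulas on sorted tuples in the common shape\<close>

text \<open>The sign that sorts \<open>j # T\<close> occurs on both sides: once between the boundary
  of \<open>j # T\<close> and \<open>omega_vector\<close>, once in the coefficient of the product of
  \<open>a_y\<close> and the monomial at \<open>S\<close>.\<close>

lemma omega_tuple_eq_smul_affine:
  assumes T: "distinct T" "set T \<subseteq> {1..n}" and S: "n + 1 \<notin> S" and sgn: "tsign T = (1 :: cpoly)"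
  shows "omega_tuple n l S T =
    (if card S = length T + 1 then
       smul (omega_functional n S (wedge (a_y n) (Poly_Mapping.single (set T) 1)))
         (proj l (omega_vector n S))
     else if card S = length T then
       smul (omega_functional n S (Poly_Mapping.single (set T) 1))
         (os_mult l (a_y n) (proj l (omega_vector n S)))
     else 0)"
proof -
  let ?I = "set T"
  have p: "card ?I = length T" using T(1) by (rule distinct_card)
  have A: "(\<Sum>j | j \<in> {1..n} \<and> S = set (j # T). smul (var j) (proj l (bdry (j # T))))
    = smul (omega_functional n S (wedge (a_y n) (Poly_Mapping.single ?I 1))) (proj l (omega_vector n S))"
    if c: "card S = length T + 1"
  proof -
    have "(\<Sum>j | j \<in> {1..n} \<and> S = set (j # T). smul (var j) (proj l (bdry (j # T))))
      = (\<Sum>j | j \<in> {1..n} \<and> S = set (j # T). smul (var j * koszul {j} ?I) (proj l (omega_vector n S)))"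
    proof (rule sum.cong[OF refl])
      fix j assume "j \<in> {j. j \<in> {1..n} \<and> S = set (j # T)}"
      then have j: "S = insert j ?I" by simp
      \<comment> \<open>Otherwise \<open>S\<close> would equal \<open>set T\<close>, which has one
        element too few.\<close>
      then have "j \<notin> ?I" using c p by (auto simp: insert_absorb)
      then have "bdry (j # T) = smul (koszul {j} ?I) (omega_vector n S)"
        using T(1) S j by (simp add: bdry_contr omega_vector_def koszul_singleton sgn)
      then show "smul (var j) (proj l (bdry (j # T)))
        = smul (var j * koszul {j} ?I) (proj l (omega_vector n S))"
        by (simp add: proj_smul smul_smul)
    qed
    also have "\<dots> = smul (\<Sum>j | j \<in> {1..n} \<and> S = set (j # T). var j * koszul {j} ?I)
        (proj l (omega_vector n S))"
      by (simp only: smul_sum_left)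
    also have "(\<Sum>j | j \<in> {1..n} \<and> S = set (j # T). var j * koszul {j} ?I)
        = omega_functional n S (wedge (a_y n) (Poly_Mapping.single ?I 1))"
      unfolding omega_functional_def lookup_wedge_a_y_single if_P[OF S]
      by (rule sum.mono_neutral_cong_left) auto
    finally show ?thesis .
  qed
  have B: "bdry T = omega_vector n S" if "S = ?I"
    using T(1) S that by (simp add: bdry_contr omega_vector_def sgn)
  show ?thesis
    using S A by (auto simp: omega_tuple_def B omega_functional_def lookup_single when_def)
qed

text \<open>Behind the formulas is the Leibniz rule: the boundary of a_y a_T is (y_1 + ... + y_n)
  a_T minus a_y times the boundary of a_T. Its coefficient at T gives the diagonal case, its
  coefficients at the sets obtained by exchanging one index give the second case. The proof verifies
  this coefficient by coefficient.\<close>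

lemma omega_tuple_eq_smul_infinity:
  assumes T: "distinct T" "set T \<subseteq> {1..n}" and S: "n + 1 \<in> S" "S \<subseteq> {1..n + 1}"
    and sgn: "tsign T = (1 :: cpoly)"
  shows "omega_tuple n l S T =
    (if card S = length T + 1 then
       smul (omega_functional n S (wedge (a_y n) (Poly_Mapping.single (set T) 1)))
         (proj l (omega_vector n S))
     else if card S = length T then
       smul (omega_functional n S (Poly_Mapping.single (set T) 1))
         (os_mult l (a_y n) (proj l (omega_vector n S)))
     else 0)"
proof -
  let ?I = "set T"
  define U where "U = S - {n + 1}"
  have U: "n + 1 \<notin> U" "U \<subseteq> {1..n}" using S by (auto simp: U_def)
  have SU: "S = U \<union> {n + 1}" using S by (auto simp: U_def)
  \<comment> \<open>Strips the index at infinity from every side condition in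
    \<open>omega_tuple\<close>, leaving conditions on subsets of \<open>{1..n}\<close>.\<close>
  have S_iff: "S = X \<union> {n + 1} \<longleftrightarrow> U = X" if "X \<subseteq> {1..n}" for X
  proof -
    have "n + 1 \<notin> X" using that by auto
    then show ?thesis using U(1) by (simp add: SU insert_ident)
  qed
  have v: "omega_vector n S = Poly_Mapping.single U 1"
    using S by (simp add: omega_vector_def U_def)
  have f: "omega_functional n S x
      = - (\<Sum>i\<in>{1..n}. koszul {i} U * Poly_Mapping.lookup x (insert i U))" for x
    using S by (simp add: omega_functional_def U_def)
  have mon_T: "mon T = (Poly_Mapping.single ?I 1 :: cpoly ext)"
    by (simp add: mon_eq_single T sgn)
  have nth_sum: "(\<Sum>k<length T. g (T ! k)) = (\<Sum>i\<in>?I. g i)" for g :: "nat \<Rightarrow> cpoly"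
    by (rule sum.reindex_bij_betw[OF bij_nth[OF T(1)]])
  \<comment> \<open>Here \<open>j\<close> is the index brought in by \<open>a_y\<close> and
    \<open>i\<close> the one removed by the boundary. Terms with \<open>j\<close> in
    \<open>T\<close> or \<open>i\<close> in \<open>U\<close> vanish through their signs.\<close>
  have fe: "omega_functional n S (wedge (a_y n) (Poly_Mapping.single ?I 1))
      = - (\<Sum>i\<in>{1..n}. \<Sum>j\<in>{1..n}.
             if insert j ?I = insert i U then koszul {i} U * (var j * koszul {j} ?I) else 0)"
    by (simp add: f lookup_wedge_a_y_single sum_distrib_left if_distrib cong: if_cong)
  have A: "omega_functional n S (wedge (a_y n) (Poly_Mapping.single ?I 1)) = - (\<Sum>j\<in>{1..n} - ?I. var j)"
    if "U = ?I"
  proof -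
    have "(\<Sum>j\<in>{1..n}. if insert j ?I = insert i U then koszul {i} U * (var j * koszul {j} ?I) else 0)
      = (if i \<in> ?I then 0 else var i)" if i: "i \<in> {1..n}" for i
    proof (cases "i \<in> ?I")
      case True
      then show ?thesis using \<open>U = ?I\<close> by (simp add: koszul_singleton_mem cong: if_cong)
    next
      case False
      \<comment> \<open>With \<open>U = set T\<close>, only the index just brought in can be removed
        again, and its two equal signs multiply to 1.\<close>
      have "(\<Sum>j\<in>{1..n}. if insert j ?I = insert i U then koszul {i} U * (var j * koszul {j} ?I) else 0)
        = (\<Sum>j\<in>{1..n}. if j = i then var i else 0)"
      proof (rule sum.cong[OF refl])
        fix j
        have "insert j ?I = insert i ?I \<longleftrightarrow> j = i" using False by (metis insertE insertI1)
        moreover have "koszul {i} ?I * (var i * koszul {i} ?I) = var i * (koszul {i} ?I * koszul {i} ?I)"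
          by (simp only: mult_ac)
        ultimately show "(if insert j ?I = insert i U then koszul {i} U * (var j * koszul {j} ?I) else 0)
          = (if j = i then var i else 0)"
          using False by (simp add: \<open>U = ?I\<close> koszul_singleton_square)
      qed
      then show ?thesis using False i by simp
    qed
    then have "omega_functional n S (wedge (a_y n) (Poly_Mapping.single ?I 1))
      = - (\<Sum>i\<in>{1..n}. if i \<in> ?I then 0 else var i)" by (simp add: fe)
    also have "(\<Sum>i\<in>{1..n}. if i \<in> ?I then 0 else var i) = (\<Sum>i\<in>{1..n} - ?I. var i)"
      by (rule sum.mono_neutral_cong_right) auto
    finally show ?thesis .
  qed
  have B: "(\<Sum>(j, k) | j \<in> {1..n} \<and> k < length T \<and> S = set (j # omit k T) \<union> {n + 1} \<and> j \<notin> ?I.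
        smul ((-1) ^ k * var j) (proj l (mon (j # omit k T))))
    = smul (omega_functional n S (wedge (a_y n) (Poly_Mapping.single ?I 1))) (proj l (omega_vector n S))"
    (is "?lhs = _") if ne: "U \<noteq> ?I"
  proof -
    \<comment> \<open>The coefficient for replacing \<open>i\<close> by \<open>j\<close>, indexed by
      the entry \<open>i\<close> rather than by its position in \<open>T\<close>: one sign takes
      \<open>i\<close> out, the other sorts \<open>j\<close> in.\<close>
    let ?g = "\<lambda>j i. if j \<notin> ?I \<and> U = insert j (?I - {i})
       then var j * (koszul {j} (?I - {i}) * koszul {i} (?I - {i})) else 0 :: cpoly"
    let ?P = "\<lambda>j k. j \<notin> ?I \<and> U = insert j (?I - {T ! k})"
    have eq: "{(j, k). j \<in> {1..n} \<and> k < length T \<and> S = set (j # omit k T) \<union> {n + 1} \<and> j \<notin> ?I}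
      = {x \<in> {1..n} \<times> {..<length T}. ?P (fst x) (snd x)}" (is "?A = ?B")
    proof -
      have iff: "S = set (j # omit k T) \<union> {n + 1} \<longleftrightarrow> U = insert j (?I - {T ! k})"
        if "j \<in> {1..n}" "k < length T" for j k
      proof -
        have "insert j (?I - {T ! k}) \<subseteq> {1..n}" using that(1) T(2) by blast
        then show ?thesis using S_iff set_omit[OF T(1) that(2)] by simp
      qed
      show ?thesis
      proof (rule set_eqI)
        fix x :: "nat \<times> nat"
        show "x \<in> ?A \<longleftrightarrow> x \<in> ?B"
          using iff[of "fst x" "snd x"]
          by (simp only: mem_Collect_eq case_prod_unfold mem_Times_iff lessThan_iff) blast
      qed
    qed
    have "?lhs = (\<Sum>(j, k)\<in>?B. smul (?g j (T ! k)) (proj l (omega_vector n S)))"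
      unfolding eq
    proof (rule sum.cong[OF refl])
      fix x assume "x \<in> ?B"
      moreover obtain j k where x: "x = (j, k)" by (cases x)
      ultimately have jk: "k < length T" "?P j k" by simp_all
      then have k: "k < length T" and Tk: "T ! k \<in> ?I" by simp_all
      have "smul ((-1) ^ k) (mon (j # omit k T))
          = Poly_Mapping.single U (koszul {j} (?I - {T ! k}) * koszul {T ! k} (?I - {T ! k}) :: cpoly)"
        using jk(2) by (simp add: mon_Cons_omit[OF T(1) k] sgn contr_koszul[OF Tk] gen_def wedge_single)
      then have "smul (var j) (proj l (smul ((-1) ^ k) (mon (j # omit k T))))
          = smul (?g j (T ! k)) (proj l (omega_vector n S))"
        using jk(2) by (simp add: v proj_single)
      then show "(case x of (j, k) \<Rightarrow> smul ((-1) ^ k * var j) (proj l (mon (j # omit k T))))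
          = (case x of (j, k) \<Rightarrow> smul (?g j (T ! k)) (proj l (omega_vector n S)))"
        by (simp only: x case_prod_conv proj_smul smul_smul mult.commute)
    qed
    also have "\<dots> = smul (\<Sum>(j, k)\<in>?B. ?g j (T ! k)) (proj l (omega_vector n S))"
      by (simp only: smul_sum_left case_prod_unfold)
    also have "(\<Sum>(j, k)\<in>?B. ?g j (T ! k)) = (\<Sum>(j, k)\<in>{1..n} \<times> {..<length T}. ?g j (T ! k))"
    proof (rule sum.mono_neutral_left)
      show "\<forall>x\<in>{1..n} \<times> {..<length T} - ?B. (case x of (j, k) \<Rightarrow> ?g j (T ! k)) = 0"
      proof
        fix x assume x: "x \<in> {1..n} \<times> {..<length T} - ?B"
        then have "\<not> ?P (fst x) (snd x)" by blast
        then show "(case x of (j, k) \<Rightarrow> ?g j (T ! k)) = 0"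
          unfolding case_prod_unfold by (rule if_not_P)
      qed
    qed auto
    also have "\<dots> = (\<Sum>j\<in>{1..n}. \<Sum>i\<in>?I. ?g j i)"
      unfolding sum.cartesian_product[symmetric] by (intro sum.cong[OF refl] nth_sum)
    \<comment> \<open>The range of \<open>i\<close> is enlarged to that of \<open>fe\<close>, so
      that the two double sums can be compared term by term.\<close>
    also have "\<dots> = (\<Sum>j\<in>{1..n}. \<Sum>i\<in>{1..n}. if i \<in> ?I then ?g j i else 0)"
      by (intro sum.cong[OF refl] sum.mono_neutral_cong_left) (use T(2) in auto)
    \<comment> \<open>The tuple formula removes \<open>i\<close> before inserting \<open>j\<close>,
      the functional does the opposite. By \<open>koszul_exchange\<close> the change of order costs
      a sign, which the minus in \<open>omega_functional\<close> absorbs.\<close>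
    also have "\<dots> = (\<Sum>j\<in>{1..n}. \<Sum>i\<in>{1..n}.
        - (if insert j ?I = insert i U then koszul {i} U * (var j * koszul {j} ?I) else 0))"
    proof (intro sum.cong[OF refl])
      fix i j
      show "(if i \<in> ?I then ?g j i else 0)
        = - (if insert j ?I = insert i U then koszul {i} U * (var j * koszul {j} ?I) else 0)"
      proof (cases "i \<in> ?I \<and> j \<notin> ?I \<and> U = insert j (?I - {i})")
        case True
        define W where "W = ?I - {i}"
        have W: "?I = insert i W" "U = insert j W" "i \<notin> W" "j \<notin> W" "i \<noteq> j" "finite W"
          using True by (auto simp: W_def)
        have "koszul {j} W * koszul {i} W = - (koszul {i} U * (koszul {j} ?I :: cpoly))"
          unfolding W(1,2) by (rule koszul_exchange[OF W(6,3-5)])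
        moreover have "insert j ?I = insert i U" unfolding W(1,2) by (rule insert_commute)
        ultimately show ?thesis using True by (simp add: W_def[symmetric] mult.left_commute)
      next
        case False
        \<comment> \<open>If both signs are nonzero, then \<open>i = j\<close> would force
          \<open>U = set T\<close>, against \<open>ne\<close>, while distinct \<open>i\<close> and
          \<open>j\<close> would be a genuine exchange, which this case excludes.\<close>
        have "koszul {i} U * (var j * koszul {j} ?I) = 0" if "insert j ?I = insert i U"
        proof (cases "i \<in> U \<or> j \<in> ?I")
          case True then show ?thesis by (auto simp: koszul_singleton_mem)
        next
          case nin: False
          with that ne have "i \<noteq> j" by (metis Diff_insert_absorb)
          have "i \<in> ?I" using that \<open>i \<noteq> j\<close> by (metis insertE insertI1)
          moreover have "U = insert j (?I - {i})"
            using that nin \<open>i \<noteq> j\<close> by (metis Diff_insert_absorb insert_Diff_if singletonD)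
          ultimately show ?thesis using False nin by blast
        qed
        then show ?thesis using False by auto
      qed
    qed
    also have "\<dots> = omega_functional n S (wedge (a_y n) (Poly_Mapping.single ?I 1))"
      unfolding fe by (subst sum.swap) (simp only: sum_negf)
    finally show ?thesis .
  qed
  have C: "(\<Sum>k | k < length T \<and> S = set (omit k T) \<union> {n + 1}.
        smul ((-1) ^ (k + 1)) (os_mult l (a_y n) (proj l (mon (omit k T)))))
    = smul (omega_functional n S (Poly_Mapping.single ?I 1)) (os_mult l (a_y n) (proj l (omega_vector n S)))"
    (is "?lhs = smul _ ?w")
  proof -
    \<comment> \<open>The minus comes from \<open>omega_functional\<close>. It accounts for the
      exponent \<open>k + 1\<close>: list positions start at 0, so the boundary itself contributes
      \<open>(-1) ^ k\<close>.\<close>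
    let ?g = "\<lambda>i. if U = ?I - {i} then - koszul {i} U else 0 :: cpoly"
    have eq: "{k. k < length T \<and> S = set (omit k T) \<union> {n + 1}}
        = {k \<in> {..<length T}. U = ?I - {T ! k}}"
    proof -
      have "S = set (omit k T) \<union> {n + 1} \<longleftrightarrow> U = ?I - {T ! k}" if "k < length T" for k
      proof -
        have "?I - {T ! k} \<subseteq> {1..n}" using T(2) by blast
        then show ?thesis using S_iff set_omit[OF T(1) that] by simp
      qed
      then show ?thesis by auto
    qed
    have "?lhs = (\<Sum>k\<in>{k \<in> {..<length T}. U = ?I - {T ! k}}. smul (?g (T ! k)) ?w)"
      unfolding eq
    proof (rule sum.cong[OF refl])
      fix k assume "k \<in> {k \<in> {..<length T}. U = ?I - {T ! k}}"
      then have k: "k < length T" and Uk: "U = ?I - {T ! k}" by simp_all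
      have "smul ((-1) ^ k) (mon (omit k T)) = smul (koszul {T ! k} U) (omega_vector n S)"
        using k by (simp add: mon_omit[OF T(1) k] sgn contr_koszul v Uk)
      then have "smul (-1) (os_mult l (a_y n) (proj l (smul ((-1) ^ k) (mon (omit k T)))))
          = smul (?g (T ! k)) ?w"
        using Uk by (simp add: proj_smul os_mult_smul smul_smul)
      then show "smul ((-1) ^ (k + 1)) (os_mult l (a_y n) (proj l (mon (omit k T)))) = smul (?g (T ! k)) ?w"
        by (simp only: proj_smul os_mult_smul smul_smul power_add power_one_right mult.commute)
    qed
    also have "\<dots> = (\<Sum>k<length T. smul (?g (T ! k)) ?w)"
      by (rule sum.mono_neutral_left) auto
    also have "\<dots> = smul (\<Sum>i\<in>?I. ?g i) ?w"
      unfolding smul_sum_left[symmetric] nth_sum[of ?g] ..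
    also have "(\<Sum>i\<in>?I. ?g i) = (\<Sum>i\<in>{1..n}. - (koszul {i} U * (if ?I = insert i U then 1 else 0)))"
    proof (rule sum.mono_neutral_cong_left)
      show "\<forall>i\<in>{1..n} - ?I. - (koszul {i} U * (if ?I = insert i U then 1 else 0)) = (0 :: cpoly)"
        by auto
      fix i assume i: "i \<in> ?I"
      \<comment> \<open>The two conditions can disagree only for \<open>i\<close> in
        \<open>U\<close>, where the sign is 0.\<close>
      show "?g i = - (koszul {i} U * (if ?I = insert i U then 1 else 0))"
      proof (cases "i \<in> U")
        case True then show ?thesis by (auto simp: koszul_singleton_mem)
      next
        case False
        then have "U = ?I - {i} \<longleftrightarrow> ?I = insert i U" using i by blast
        then show ?thesis by simp
      qed
    qed (use T(2) in auto)
    also have "\<dots> = omega_functional n S (Poly_Mapping.single ?I 1)"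
      by (simp only: f sum_negf lookup_single when_def)
    finally show ?thesis .
  qed
  show ?thesis
  proof (cases "card S = length T + 1")
    case True
    show ?thesis
    proof (cases "U = ?I")
      case True
      then have "S = ?I \<union> {n + 1}" using SU by simp
      then show ?thesis
        unfolding omega_tuple_def Let_def A[OF True] v mon_T
        using \<open>card S = length T + 1\<close> S(1) True by simp
    next
      case False
      then have "S \<noteq> ?I \<union> {n + 1}" using S_iff[OF T(2)] by simp
      then show ?thesis
        unfolding omega_tuple_def Let_def B[OF False]
        using True S(1) by simp
    qed
  next
    case False
    then show ?thesis unfolding omega_tuple_def Let_def C using S(1) by simp
  qed
qed

section \<open>Linear extension and the cochain property\<close>

text \<open>Both sides are linear in \<open>\<eta>\<close>, so the formulas on sorted tuples
  suffice; for these \<open>tsign\<close> is 1.\<close>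

lemma omega_eq_smul:
  assumes "S \<subseteq> {1..n + 1}" "\<eta> \<in> os_term n l p"
  shows "omega n l S p \<eta> =
    (if card S = p + 1 then
       smul (omega_functional n S (wedge (a_y n) \<eta>)) (proj l (omega_vector n S))
     else if card S = p then
       smul (omega_functional n S \<eta>) (os_mult l (a_y n) (proj l (omega_vector n S)))
     else 0)"
proof -
  let ?A = "{I. I \<subseteq> {1..n} \<and> card I = p}"
  let ?s = "\<lambda>I. Poly_Mapping.single I 1 :: cpoly ext"
  have fin: "finite ?A" by (rule finite_subset[of _ "Pow {1..n}"]) auto
  have \<eta>: "\<eta> = (\<Sum>I\<in>?A. smul (Poly_Mapping.lookup \<eta> I) (?s I))"
    using assms(2) by (intro sum_smul_single[symmetric] fin) (auto simp: os_term_def)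
  have f1: "omega_functional n S \<eta>
      = (\<Sum>I\<in>?A. Poly_Mapping.lookup \<eta> I * omega_functional n S (?s I))"
    by (subst \<eta>) (simp only: omega_functional_sum omega_functional_smul)
  have f2: "omega_functional n S (wedge (a_y n) \<eta>)
      = (\<Sum>I\<in>?A. Poly_Mapping.lookup \<eta> I * omega_functional n S (wedge (a_y n) (?s I)))"
    by (subst \<eta>) (simp only: wedge_sum_right[OF fin] wedge_smul_right
        omega_functional_sum omega_functional_smul)
  have "omega n l S p \<eta> = (\<Sum>I\<in>?A. smul (Poly_Mapping.lookup \<eta> I)
    (if card S = p + 1 then
       smul (omega_functional n S (wedge (a_y n) (?s I))) (proj l (omega_vector n S))
     else if card S = p then
       smul (omega_functional n S (?s I)) (os_mult l (a_y n) (proj l (omega_vector n S)))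
     else 0))"
    unfolding omega_def
  proof (rule sum.cong[OF refl])
    fix I assume I: "I \<in> ?A"
    then have "finite I" by (auto intro: finite_subset)
    with I show "smul (Poly_Mapping.lookup \<eta> I) (omega_tuple n l S (sorted_list_of_set I))
      = smul (Poly_Mapping.lookup \<eta> I)
    (if card S = p + 1 then
       smul (omega_functional n S (wedge (a_y n) (?s I))) (proj l (omega_vector n S))
     else if card S = p then
       smul (omega_functional n S (?s I)) (os_mult l (a_y n) (proj l (omega_vector n S)))
     else 0)"
      using omega_tuple_eq_smul_affine[of "sorted_list_of_set I" n S l]
        omega_tuple_eq_smul_infinity[of "sorted_list_of_set I" n S l] assms(1)
      by (cases "n + 1 \<in> S") (simp_all add: tsign_sorted)
  qed
  also have "\<dots> = (if card S = p + 1 then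
       smul (omega_functional n S (wedge (a_y n) \<eta>)) (proj l (omega_vector n S))
     else if card S = p then
       smul (omega_functional n S \<eta>) (os_mult l (a_y n) (proj l (omega_vector n S)))
     else 0)"
    by (simp add: f1 f2 smul_sum_left smul_smul)
  finally show ?thesis .
qed

lemma omega_os_term:
  assumes "S \<subseteq> {1..n + 1}" "\<eta> \<in> os_term n l p"
  shows "omega n l S p \<eta> \<in> os_term n l p"
proof -
  have *: "Poly_Mapping.lookup \<eta> I \<in> poly_ring n" for I using assms(2) by (simp add: os_term_def)
  have "os_mult l (a_y n) (proj l (omega_vector n S)) \<in> os_term n l p" if "card S = p"
  proof (cases p)
    case 0
    then have "S = {}" using that finite_subset[OF assms(1)] by simp
    then show ?thesis by (simp add: proj_omega_vector_empty)
  next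
    case (Suc m)
    then show ?thesis
      using os_mult_a_y_os_term[OF proj_omega_vector_os_term[OF assms(1), of m]] that by simp
  qed
  then show ?thesis
    using proj_omega_vector_os_term[OF assms(1), of p l]
    by (simp add: omega_eq_smul[OF assms] os_term_smul omega_functional_poly_ring *
        lookup_wedge_poly_ring lookup_a_y_poly_ring)
qed

text \<open>Below the top degree, \<open>omega_eq_smul\<close> leaves three values of
  \<open>card S\<close>. For \<open>p + 2\<close> the right side is 0 and the left contains the
  functional of a_y a_y \<eta>. For \<open>p + 1\<close> both sides are the same multiple of a_y v.
  For \<open>p\<close> the left side is 0 and the right contains a_y a_y v. For any other value both
  sides are 0.\<close>

lemma omega_os_mult_a_y:
  assumes "1 \<le> l" "S \<subseteq> {1..n + 1}" "\<eta> \<in> os_term n l p"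
  shows "omega n l S (p + 1) (os_mult l (a_y n) \<eta>) = os_mult l (a_y n) (omega n l S p \<eta>)"
proof (cases "p + 1 \<le> l")
  case True
  let ?e\<eta> = "wedge (a_y n) \<eta>"
  note m = os_mult_a_y_os_term[OF assms(3), unfolded os_mult_a_y_eq_wedge[OF assms(3) True]]
  have ee: "wedge (a_y n) ?e\<eta> = 0"
    by (rule wedge_a_y_twice[OF os_term_finite_keys[OF assms(3)]])
  have fin: "\<forall>I\<in>Poly_Mapping.keys (proj l (omega_vector n S)). finite I"
  proof (cases "card S")
    case 0
    then have "S = {}" using finite_subset[OF assms(2)] by simp
    then show ?thesis by (simp add: proj_omega_vector_empty)
  next
    case (Suc q)
    then show ?thesis
      by (intro os_term_finite_keys[OF proj_omega_vector_os_term[OF assms(2)]]) simp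
  qed
  show ?thesis
    unfolding os_mult_a_y_eq_wedge[OF assms(3) True] omega_eq_smul[OF assms(2) m]
      omega_eq_smul[OF assms(2,3)]
    by (simp add: ee os_mult_smul os_mult_a_y_twice[OF assms(1) fin])
next
  case False
  \<comment> \<open>Both products lie in degree \<open>p + 1 > l\<close>, where the complex is
    zero.\<close>
  have "os_mult l (a_y n) \<eta> = 0" "os_mult l (a_y n) (omega n l S p \<eta>) = 0"
    using False os_term_above[OF _ os_mult_a_y_os_term] assms(3) omega_os_term[OF assms(2,3)]
    by (meson not_le)+
  then show ?thesis by (simp add: omega_def)
qed

theorem proposition4p2:
  fixes n l :: nat and S :: "nat set"
  assumes "1 \<le> l" and "l \<le> n" and "S \<subseteq> {1..n + 1}"
  shows "cochain_hom n l (omega n l S)"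
  unfolding cochain_hom_def
proof (intro allI conjI ballI)
  fix p \<eta> assume \<eta>: "\<eta> \<in> os_term n l p"
  show "omega n l S p \<eta> \<in> os_term n l p" by (rule omega_os_term[OF assms(3) \<eta>])
  show "omega n l S p (\<eta> + \<xi>) = omega n l S p \<eta> + omega n l S p \<xi>" for \<xi>
    by (simp add: omega_def lookup_add smul_add_left sum.distrib)
  show "omega n l S p (smul r \<eta>) = smul r (omega n l S p \<eta>)" for r
    by (simp add: omega_def smul_sum smul_smul)
  show "omega n l S (p + 1) (os_mult l (a_y n) \<eta>) = os_mult l (a_y n) (omega n l S p \<eta>)"
    by (rule omega_os_mult_a_y[OF assms(1,3) \<eta>])
qed

end
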